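(* Let $G=(V,E)$ be a graph with maximum degree $\Delta$, and let $D\geq\Delta$ be a positive integer. Let $\mathbf{u}=\{u_0,u_1,u_2,\ldots\}$ be a sequence of nonnegative real numbers such that $$\Gamma(D,\mathbf{u},y):=\sum_{k=0}^{D}\binom{D}{k}u_k y^k$$ is a polynomial with only real nonpositive zeros. Then the polynomial $\sum_{j}N(G;\mathbf{u},j)\,t^{j}$ has only real nonpositive zeros.
   Context: A graph $G=(V,E)$ is a finite undirected multigraph (loops and multiple edges allowed). Spanning subgraphs are identified with edge subsets $H\subseteq E$, and $\deg(H,v)$ is the degree of $v\in V$ in $(V,H)$, a loop contributing $2$. For a sequence $\mathbf{u}=\{u_0,u_1,\ldots\}$ of nonnegative real numbers (fugacities) and $H\subseteq E$, put $\mathbf{u}_{\deg(H)}:=\prod_{v\in V}u_{\deg(H,v)}$, and for each natural number $j\ge 0$ put $N(G;\mathbf{u},j):=\sum_{H\subseteq E:\ \#H=j}\mathbf{u}_{\deg(H)}$. Convention: the identically zero polynomial is regarded as having only real nonpositive zeros. *)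

theory Defs
  imports
    Complex_Main
    "HOL-Library.Multiset"
    "HOL-Library.Nonpos_Ints"
    "HOL-Computational_Algebra.Polynomial"
begin

text \<open>
  An edge is attached to a two-element multiset of endpoints: \<open>{#v, w#}\<close> for an ordinary edge,
  \<open>{#v, v#}\<close> for a loop.  Distinct edges may have equal endpoints, so parallel edges are allowed.
\<close>

record ('v, 'e) multigraph =
  verts :: "'v set"
  edges :: "'e set"
  ends :: "'e \<Rightarrow> 'v multiset"

locale finite_multigraph =
  fixes G :: "('v, 'e) multigraph" (structure)
  assumes finite_verts: "finite (verts G)"
    and finite_edges: "finite (edges G)"
    and size_ends: "\<And>e. e \<in> edges G \<Longrightarrow> size (ends G e) = 2"
    and ends_in_verts: "\<And>e. e \<in> edges G \<Longrightarrow> set_mset (ends G e) \<subseteq> verts G"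

text \<open>Counting with multiplicity makes a loop contribute 2.\<close>

definition sub_degree :: "('v, 'e) multigraph \<Rightarrow> 'e set \<Rightarrow> 'v \<Rightarrow> nat" where
  "sub_degree G H v = (\<Sum>e\<in>H. count (ends G e) v)"

text \<open>The inserted 0 matters only for the graph without vertices.\<close>

definition max_degree :: "('v, 'e) multigraph \<Rightarrow> nat" where
  "max_degree G = Max (insert 0 (sub_degree G (edges G) ` verts G))"

definition sub_weight :: "('v, 'e) multigraph \<Rightarrow> (nat \<Rightarrow> real) \<Rightarrow> 'e set \<Rightarrow> real" where
  "sub_weight G u H = (\<Prod>v\<in>verts G. u (sub_degree G H v))"

definition N :: "('v, 'e) multigraph \<Rightarrow> (nat \<Rightarrow> real) \<Rightarrow> nat \<Rightarrow> real" where
  "N G u j = (\<Sum>H | H \<subseteq> edges G \<and> card H = j. sub_weight G u H)"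

text \<open>
  Since \<open>N G u j = 0\<close> for \<open>j > card (edges G)\<close>, the sum over all \<open>j\<close> may be cut off there;
  see \<open>coeff_N_poly\<close> below.
\<close>

definition N_poly :: "('v, 'e) multigraph \<Rightarrow> (nat \<Rightarrow> real) \<Rightarrow> real poly" where
  "N_poly G u = (\<Sum>j\<le>card (edges G). monom (N G u j) j)"

definition Gamma_poly :: "nat \<Rightarrow> (nat \<Rightarrow> real) \<Rightarrow> real poly" where
  "Gamma_poly D u = (\<Sum>k\<le>D. monom (real (D choose k) * u k) k)"

text \<open>
  All complex zeros are considered.  By convention the zero polynomial has the property;
  nonzero constants have it vacuously.
\<close>

definition only_real_nonpos_zeros :: "real poly \<Rightarrow> bool" where
  "only_real_nonpos_zeros p \<longleftrightarrow>
     p = 0 \<or> (\<forall>z::complex. poly (map_poly complex_of_real p) z = 0 \<longrightarrow> z \<in> \<real>\<^sub>\<le>\<^sub>0)"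

lemma (in finite_multigraph) coeff_N_poly: "coeff (N_poly G u) j = N G u j"
proof -
  have "N G u j = 0" if "j > card (edges G)"
  proof -
    have "card H \<noteq> j" if "H \<subseteq> edges G" for H
      using card_mono[OF finite_edges that] \<open>j > card (edges G)\<close> by linarith
    then have none: "{H. H \<subseteq> edges G \<and> card H = j} = {}"
      by blast
    show ?thesis unfolding N_def none by (rule sum.empty)
  qed
  then show ?thesis
    by (simp add: N_poly_def coeff_sum not_le)
qed

end

theory Submission
  imports Defs
    "HOL-Complex_Analysis.Great_Picard"
    "HOL-Computational_Algebra.Fundamental_Theorem_Algebra"
begin

text \<open>
  Suppose first that all zeros of \<open>\<Gamma>\<close> are strictly negative.  For \<open>t\<close> off the closed negative real
  axis write \<open>t = s\<^sup>2\<close> with \<open>Re s > 0\<close>; then \<open>c\<^sub>k = u\<^sub>k s\<^sup>k\<close> makes \<open>\<Gamma>(D, c, y) = \<Gamma>(D, u, s y)\<close>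
  zero-free on the closed right half-plane.  Grace--Walsh--Szego makes its polarizations, taken at
  each vertex in one variable per half-edge, zero-free for all variables in that half-plane, hence so
  is their product over the vertices.  Identifying the two halves of an edge
  (\<open>a + b x + c y + d x y \<mapsto> a + d\<close>) keeps this product nonzero; after all edges have been contracted,
  what remains is the sum over \<open>H\<close> of \<open>u\<^bsub>deg H\<^esub> s\<^bsup>2 #H\<^esup>\<close>, the value of the
  enumerator at \<open>t\<close>.  In general, approximate \<open>\<Gamma>(y)\<close> by \<open>\<Gamma>(y + \<epsilon>)\<close> and apply Hurwitz's theorem.
\<close>

subsection \<open>Polarization and the right half-plane\<close>

text \<open>Over any semiring, to cover both the real \<open>Gamma_poly\<close> and complex
  sequences. With the binomial split off, \<open>u k\<close> is the coefficient of the k-th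
  elementary symmetric polynomial in the polarization.\<close>

definition binom_poly :: "nat \<Rightarrow> (nat \<Rightarrow> 'a::comm_semiring_1) \<Rightarrow> 'a poly" where
  "binom_poly n u = (\<Sum>k\<le>n. monom (of_nat (n choose k) * u k) k)"

lemma coeff_binom_poly: "coeff (binom_poly n u) k = of_nat (n choose k) * u k"
  by (simp add: binom_poly_def coeff_sum not_le) (simp add: binomial_eq_0)

lemma degree_binom_poly: "degree (binom_poly n u) \<le> n"
  by (rule degree_le) (simp add: coeff_binom_poly binomial_eq_0)

lemma binom_poly_Suc:
  "binom_poly (Suc n) u = binom_poly n u + pCons 0 (binom_poly n (\<lambda>k. u (Suc k)))"
  by (rule poly_eqI)
    (auto simp: coeff_binom_poly coeff_pCons algebra_simps split: nat.splits)

lemma pderiv_binom_poly_Suc: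
  fixes u :: "nat \<Rightarrow> 'a::idom"
  shows "pderiv (binom_poly (Suc n) u) = smult (of_nat (Suc n)) (binom_poly n (\<lambda>k. u (Suc k)))"
proof (rule poly_eqI)
  fix k
  have "of_nat (Suc k) * (of_nat (Suc n choose Suc k) :: 'a) = of_nat (Suc n) * of_nat (n choose k)"
    by (metis Suc_times_binomial of_nat_mult)
  then show "coeff (pderiv (binom_poly (Suc n) u)) k =
      coeff (smult (of_nat (Suc n)) (binom_poly n (\<lambda>k. u (Suc k)))) k"
    by (simp only: coeff_pderiv coeff_binom_poly coeff_smult mult.assoc[symmetric])
qed

lemma binom_poly_add_smult:
  "binom_poly n (\<lambda>k. u k + z * v k) = binom_poly n u + smult z (binom_poly n v)"
  by (rule poly_eqI) (simp add: coeff_binom_poly algebra_simps)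

text \<open>
  With \<open>w = 1 / (y - r)\<close> and \<open>a = Re y\<close>, the condition \<open>Re r < 0\<close> says \<open>a \<bar>w\<bar>\<^sup>2 < Re w\<close>, a convex
  condition on \<open>w\<close>; the logarithmic derivative is \<open>degree p\<close> times an average of such \<open>w\<close>.
\<close>

lemma log_derivative_disc:
  fixes p :: "complex poly"
  assumes "\<And>z. 0 \<le> Re z \<Longrightarrow> poly p z \<noteq> 0" and "0 \<le> Re y" and "0 < degree p"
  shows "Re y * (cmod (poly (pderiv p) y / poly p y))\<^sup>2
    < real (degree p) * Re (poly (pderiv p) y / poly p y)"
  using assms(1,3)
proof (induction "degree p" arbitrary: p)
  case 0
  then show ?case by simp
next
  case (Suc m)
  obtain r where r: "poly p r = 0"
    using fundamental_theorem_of_algebra[of p] Suc.prems(2) by (auto simp: constant_degree)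
  then obtain q where p: "p = [:-r, 1:] * q"
    by (auto simp: poly_eq_0_iff_dvd elim: dvdE)
  have "q \<noteq> 0" using p Suc.prems(2) by auto
  then have dp: "degree p = Suc (degree q)"
    unfolding p by (subst degree_mult_eq) auto
  have q: "poly q z \<noteq> 0" if "0 \<le> Re z" for z
    using Suc.prems(1)[OF that] by (auto simp: p)
  define w where "w = 1 / (y - r)"
  define l where "l = poly (pderiv q) y / poly q y"
  have "Re r < 0" using Suc.prems(1)[of r] r by force
  have yr: "y - r \<noteq> 0" using \<open>Re r < 0\<close> \<open>0 \<le> Re y\<close> by auto
  have "poly (pderiv p) y = (y - r) * poly (pderiv q) y + poly q y"
    by (simp only: p pderiv_mult poly_add poly_mult) (simp add: pderiv_pCons)
  moreover have "poly p y = (y - r) * poly q y"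
    by (simp only: p poly_mult) simp
  ultimately have wl: "poly (pderiv p) y / poly p y = l + w"
    using yr q[OF \<open>0 \<le> Re y\<close>] by (simp add: w_def l_def add_divide_distrib)
  have "w \<noteq> 0" using yr by (simp add: w_def)
  have "Re w = Re (y - r) * (cmod w)\<^sup>2"
    by (simp add: w_def Re_divide cmod_power2[symmetric] norm_divide power_divide)
      (simp add: cmod_power2)
  then have w: "Re y * (cmod w)\<^sup>2 < Re w"
    using \<open>Re r < 0\<close> \<open>w \<noteq> 0\<close> by simp
  show ?case
  \<comment> \<open>The induction hypothesis demands positive degree; a constant \<open>q\<close>
    gives \<open>l = 0\<close>, which leaves the bound for \<open>w\<close> alone.\<close>
  proof (cases "degree q = 0")
    case True
    then have "l = 0"
      by (metis l_def degree_eq_zeroE divide_eq_0_iff pderiv_pCons pderiv_0 poly_0 add.right_neutral pCons_0_0)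
    then show ?thesis using w True by (simp add: wl dp)
  next
    case False
    define m' where "m' = real (degree q)"
    have m': "m' > 0" using False by (simp add: m'_def)
    have l: "Re y * (cmod l)\<^sup>2 < m' * Re l"
      using Suc.hyps(1)[of q] Suc.hyps(2) q False by (simp add: dp l_def m'_def)
    have "m' * (cmod (l + w))\<^sup>2 \<le> m' * (cmod l + cmod w)\<^sup>2"
      using m' by (intro mult_left_mono power_mono norm_triangle_ineq) auto
    \<comment> \<open>Right side minus left side is (|l| - m' |w|)^2: convexity of the square for
      the average of l / m' and w with weights m' and 1.\<close>
    also have "\<dots> \<le> (m' + 1) * (cmod l)\<^sup>2 + m' * (m' + 1) * (cmod w)\<^sup>2"
      using zero_le_power2[of "cmod l - m' * cmod w"]
      by (simp add: power2_eq_square algebra_simps)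
    finally have "Re y * (m' * (cmod (l + w))\<^sup>2)
        \<le> Re y * ((m' + 1) * (cmod l)\<^sup>2 + m' * (m' + 1) * (cmod w)\<^sup>2)"
      using \<open>0 \<le> Re y\<close> by (rule mult_left_mono)
    also have "\<dots> = (m' + 1) * (Re y * (cmod l)\<^sup>2) + m' * (m' + 1) * (Re y * (cmod w)\<^sup>2)"
      by (simp add: algebra_simps)
    also have "\<dots> < (m' + 1) * (m' * Re l) + m' * (m' + 1) * Re w"
      using l w m' by (intro add_strict_mono mult_strict_left_mono) auto
    also have "\<dots> = m' * ((m' + 1) * Re (l + w))"
      by (simp add: algebra_simps)
    finally have "Re y * (cmod (l + w))\<^sup>2 < (m' + 1) * Re (l + w)"
      using m' by (simp add: mult.left_commute[of _ m'])
    then show ?thesis by (simp add: wl dp m'_def add.commute)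
  qed
qed

text \<open>
  The new polynomial is \<open>p + (z - y) p' / (n + 1)\<close> with \<open>p = binom_poly (Suc n) u\<close>, Laguerre's polar
  derivative.  If it vanished at \<open>y\<close>, then \<open>p' / ((n + 1) p) = 1 / (y - z)\<close> would lie outside the
  disc of \<open>log_derivative_disc\<close>.
\<close>

lemma laguerre_step:
  fixes u :: "nat \<Rightarrow> complex"
  assumes nz: "\<And>y. 0 \<le> Re y \<Longrightarrow> poly (binom_poly (Suc n) u) y \<noteq> 0"
    and z: "0 \<le> Re z" and y: "0 \<le> Re y"
  shows "poly (binom_poly n (\<lambda>k. u k + z * u (Suc k))) y \<noteq> 0"
proof
  define p where "p = binom_poly (Suc n) u"
  define B where "B = poly (binom_poly n (\<lambda>k. u (Suc k))) y"
  define w where "w = B / poly p y"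
  assume "poly (binom_poly n (\<lambda>k. u k + z * u (Suc k))) y = 0"
  then have B: "poly p y = (y - z) * B"
    by (simp add: binom_poly_add_smult p_def binom_poly_Suc B_def algebra_simps eq_neg_iff_add_eq_0)
  have py: "poly p y \<noteq> 0" using nz[OF y] by (simp add: p_def)
  then have "B \<noteq> 0" "y - z \<noteq> 0" using B by auto
  then have w: "w = 1 / (y - z)" by (simp add: w_def B)
  have dp: "poly (pderiv p) y = of_nat (Suc n) * B"
    by (simp add: p_def pderiv_binom_poly_Suc B_def)
  have "poly (pderiv p) y \<noteq> 0"
    using \<open>B \<noteq> 0\<close> by (simp only: dp mult_eq_0_iff of_nat_eq_0_iff) simp
  then have deg: "degree p > 0"
    by (metis degree_eq_zeroE gr0I pderiv_pCons pderiv_0 poly_0 add.right_neutral pCons_0_0)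
  have L: "poly (pderiv p) y / poly p y = of_nat (Suc n) * w"
    by (simp only: dp w_def times_divide_eq_right)
  have Re_L: "Re (of_nat (Suc n) * w) = real (Suc n) * Re w"
    by (simp only: times_complex.sel complex_Re_of_nat complex_Im_of_nat mult_zero_left diff_zero)
  have "Re y * (cmod (of_nat (Suc n) * w))\<^sup>2 < real (degree p) * Re (of_nat (Suc n) * w)"
    using log_derivative_disc[OF nz[folded p_def] y deg, unfolded L] .
  then have less: "Re y * (real (Suc n) * cmod w)\<^sup>2 < real (degree p) * (real (Suc n) * Re w)"
    by (simp only: Re_L norm_mult norm_of_nat)
  have "0 \<le> Re y * (real (Suc n) * cmod w)\<^sup>2" using y by simp
  with less have "0 < real (degree p) * (real (Suc n) * Re w)" by linarith
  then have "0 < Re w" using deg by (simp add: zero_less_mult_iff)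
  \<comment> \<open>The degree of \<open>p\<close> may be smaller than \<open>Suc n\<close>; as
    \<open>Re w\<close> is positive, the bound survives replacing it by
    \<open>Suc n\<close>.\<close>
  have "real (degree p) * (real (Suc n) * Re w) \<le> real (Suc n) * (real (Suc n) * Re w)"
    using degree_binom_poly[of "Suc n" u] \<open>0 < Re w\<close> by (intro mult_right_mono) (auto simp: p_def)
  with less have "(real (Suc n))\<^sup>2 * (Re y * (cmod w)\<^sup>2) < (real (Suc n))\<^sup>2 * Re w"
    by (simp only: power_mult_distrib power2_eq_square mult_ac)
  then have "Re y * (cmod w)\<^sup>2 < Re w"
    by (subst (asm) mult_less_cancel_left_pos) auto
  moreover have "Re w = Re (y - z) * (cmod w)\<^sup>2"
    by (simp add: w Re_divide cmod_power2[symmetric] norm_divide power_divide)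
      (simp add: cmod_power2)
  moreover have "Re (y - z) * (cmod w)\<^sup>2 \<le> Re y * (cmod w)\<^sup>2"
    using z by (intro mult_right_mono) auto
  ultimately show False by linarith
qed

text \<open>Serves vertices of degree below \<open>D\<close>: Laguerre's step at z = 0 lowers the
  index by one and leaves \<open>u\<close> unchanged.\<close>

lemma binom_poly_le_nonzero:
  fixes u :: "nat \<Rightarrow> complex"
  assumes "n \<le> D" and "\<And>y. 0 \<le> Re y \<Longrightarrow> poly (binom_poly D u) y \<noteq> 0" and "0 \<le> Re y"
  shows "poly (binom_poly n u) y \<noteq> 0"
  using assms
proof (induction arbitrary: y rule: inc_induct)
  case (step n)
  then show ?case using laguerre_step[of n u 0 y] by simp
qed simp

lemma sum_Pow_insert:
  fixes f :: "'a set \<Rightarrow> 'b::comm_monoid_add"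
  assumes "finite A" "a \<notin> A"
  shows "(\<Sum>S\<in>Pow (insert a A). f S) = (\<Sum>S\<in>Pow A. f S + f (insert a S))"
proof -
  have "inj_on (insert a) (Pow A)"
    using assms(2) by (intro inj_onI) (metis PowD insert_ident subsetD)
  then show ?thesis using assms
    by (simp add: Pow_insert sum.distrib)
      (subst sum.union_disjoint, auto simp: sum.reindex)
qed

text \<open>Induction on the variables: the sum is affine in \<open>x a\<close>, and fixing
  \<open>x a\<close> leaves the same kind of sum over \<open>A\<close> for the sequence
  \<open>u k + x a * u (Suc k)\<close>, to which \<open>laguerre_step\<close> applies.\<close>

lemma grace_walsh_szego:
  fixes u :: "nat \<Rightarrow> complex"
  assumes "finite A" and "\<And>y. 0 \<le> Re y \<Longrightarrow> poly (binom_poly (card A) u) y \<noteq> 0"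
    and "\<And>a. a \<in> A \<Longrightarrow> 0 \<le> Re (x a)"
  shows "(\<Sum>S\<in>Pow A. u (card S) * (\<Prod>a\<in>S. x a)) \<noteq> 0"
  using assms
proof (induction A arbitrary: u rule: finite_induct)
  case empty
  then show ?case using empty(1)[of 0] by (simp add: binom_poly_def poly_monom)
next
  case (insert a A)
  have "(\<Sum>S\<in>Pow (insert a A). u (card S) * (\<Prod>a\<in>S. x a))
      = (\<Sum>S\<in>Pow A. (u (card S) + x a * u (Suc (card S))) * (\<Prod>a\<in>S. x a))"
    unfolding sum_Pow_insert[OF insert(1,2)]
  proof (rule sum.cong[OF refl])
    fix S assume "S \<in> Pow A"
    then have "finite S" "a \<notin> S" using insert(1,2) finite_subset by auto
    then show "u (card S) * (\<Prod>a\<in>S. x a) + u (card (insert a S)) * (\<Prod>a\<in>insert a S. x a)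
        = (u (card S) + x a * u (Suc (card S))) * (\<Prod>a\<in>S. x a)"
      by (simp add: algebra_simps)
  qed
  also have "\<dots> \<noteq> 0"
    using insert.prems insert.hyps laguerre_step[of "card A" u "x a"]
    by (intro insert.IH) auto
  finally show ?case .
qed

subsection \<open>Contracting edges\<close>

text \<open>
  On the diagonal the hypothesis puts both roots of a quadratic into the open left half-plane, where
  no two numbers have product \<open>-1\<close>.
\<close>

lemma asano_contraction:
  fixes a b c d :: complex
  assumes nz: "\<And>x y. 0 \<le> Re x \<Longrightarrow> 0 \<le> Re y \<Longrightarrow> a + b * x + c * y + d * x * y \<noteq> 0"
  shows "a + d \<noteq> 0"
proof
  assume ad: "a + d = 0"
  have "a \<noteq> 0" using nz[of 0 0] by simp
  then have "d \<noteq> 0" using ad by auto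
  \<comment> \<open>The diagonal quadratic a + (b + c) x + d x^2 has discriminant (b + c)^2 - 4 a d,
    and here a = - d.\<close>
  define r where "r = csqrt ((b + c)\<^sup>2 + 4 * d\<^sup>2)"
  define r1 where "r1 = (- (b + c) + r) / (2 * d)"
  define r2 where "r2 = (- (b + c) - r) / (2 * d)"
  have rr: "r\<^sup>2 = (b + c)\<^sup>2 + 4 * d\<^sup>2" by (simp add: r_def)
  have prod: "r1 * r2 = - 1"
  proof -
    have "r1 * r2 = ((b + c)\<^sup>2 - r\<^sup>2) / (4 * d\<^sup>2)"
      by (simp add: r1_def r2_def power2_eq_square algebra_simps)
    then show ?thesis using \<open>d \<noteq> 0\<close> by (simp add: rr)
  qed
  have sum: "d * (r1 + r2) = - (b + c)"
    using \<open>d \<noteq> 0\<close> by (simp add: r1_def r2_def field_simps)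
  have "d * (x - r1) * (x - r2) = a + b * x + c * x + d * x * x" for x
  proof -
    have "d * (x - r1) * (x - r2) = d * x * x - d * (r1 + r2) * x + d * (r1 * r2)"
      by (simp add: algebra_simps)
    also have "\<dots> = a + b * x + c * x + d * x * x"
      unfolding sum prod using ad by (simp add: algebra_simps eq_neg_iff_add_eq_0)
    finally show ?thesis .
  qed
  then have "Re r1 < 0" "Re r2 < 0"
    using nz[of r1 r1] nz[of r2 r2] by (metis mult_zero_left mult_zero_right diff_self not_le)+
  \<comment> \<open>Taking reciprocals preserves the sign of the real part, so - 1 /
    \<open>r1\<close> lies in the right half-plane once \<open>r1\<close> lies in the left
    one.\<close>
  moreover have "r2 = - 1 / r1"
    using prod by (metis mult_zero_left neg_equal_0_iff_equal nonzero_eq_divide_eq mult.commute one_neq_zero)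
  then have "Re r2 = - Re r1 / (cmod r1)\<^sup>2"
    by (simp add: Re_divide cmod_power2)
  ultimately show False
    by (smt (verit) divide_nonneg_nonneg zero_le_power2)
qed

text \<open>One edge at a time: with all other variables fixed, the sum is affine in each half of
  \<open>e\<close>, and \<open>asano_contraction\<close> keeps just the terms containing both halves
  or neither.\<close>

lemma contract_edges:
  fixes g :: "('e \<times> bool) set \<Rightarrow> complex"
  assumes "finite E"
    and "\<And>x. (\<And>h. 0 \<le> Re (x h)) \<Longrightarrow> (\<Sum>S\<in>Pow (E \<times> UNIV). g S * (\<Prod>h\<in>S. x h)) \<noteq> 0"
  shows "(\<Sum>T\<in>Pow E. g (T \<times> UNIV)) \<noteq> 0"
  using assms
proof (induction E arbitrary: g rule: finite_induct)
  case empty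
  then show ?case using empty(1)[of "\<lambda>_. 0"] by simp
next
  case (insert e E)
  define g' where "g' S = g S + g (insert (e, True) (insert (e, False) S))" for S
  have ins: "insert e T \<times> UNIV = insert (e, True) (insert (e, False) (T \<times> UNIV))" for T :: "'e set"
    by (auto simp: UNIV_bool)
  have fin: "finite (E \<times> (UNIV :: bool set))" using insert(1) by simp
  have "(\<Sum>T\<in>Pow E. g' (T \<times> UNIV)) \<noteq> 0"
  proof (rule insert.IH)
    fix x :: "'e \<times> bool \<Rightarrow> complex"
    assume x: "\<And>h. 0 \<le> Re (x h)"
    \<comment> \<open>\<open>P F\<close> gathers the terms whose trace on the two halves of
      \<open>e\<close> is exactly \<open>F\<close>, stripped of the variables of
      \<open>e\<close>.\<close>
    define P where "P F = (\<Sum>S\<in>Pow (E \<times> UNIV). g (F \<union> S) * (\<Prod>h\<in>S. x h))" for F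
    have expand: "(\<Sum>S\<in>Pow (insert e E \<times> UNIV). g S * (\<Prod>h\<in>S. (x((e, True) := X, (e, False) := Y)) h))
        = P {} + P {(e, True)} * X + P {(e, False)} * Y + P {(e, True), (e, False)} * X * Y" for X Y
    proof -
      let ?x = "x((e, True) := X, (e, False) := Y)"
      have prods: "prod ?x S = prod x S" "finite S" "(e, True) \<notin> S" "(e, False) \<notin> S"
        if "S \<in> Pow (E \<times> UNIV)" for S
      proof -
        show "finite S" using that fin finite_subset by auto
        show "(e, True) \<notin> S" "(e, False) \<notin> S" using that insert(2) by auto
        then show "prod ?x S = prod x S" by (intro prod.cong) auto
      qed
      have "(\<Sum>S\<in>Pow (insert e E \<times> UNIV). g S * prod ?x S)
          = (\<Sum>S\<in>Pow (E \<times> UNIV). g S * prod ?x S + g (insert (e, True) S) * prod ?x (insert (e, True) S)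
            + (g (insert (e, False) S) * prod ?x (insert (e, False) S)
              + g (insert (e, True) (insert (e, False) S)) * prod ?x (insert (e, True) (insert (e, False) S))))"
        unfolding ins using insert(2) fin
        by (subst sum_Pow_insert; (simp; fail)?)+
      also have "\<dots> = (\<Sum>S\<in>Pow (E \<times> UNIV). g S * prod x S + g (insert (e, True) S) * prod x S * X
            + g (insert (e, False) S) * prod x S * Y
            + g (insert (e, True) (insert (e, False) S)) * prod x S * X * Y)"
      proof (rule sum.cong[OF refl], goal_cases)
        case (1 S)
        have "?x (e, True) = X" "?x (e, False) = Y" by simp_all
        then show ?case using prods[OF 1] by (simp add: mult_ac del: fun_upd_apply)
      qed
      also have "\<dots> = P {} + P {(e, True)} * X + P {(e, False)} * Y + P {(e, True), (e, False)} * X * Y"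
        by (simp add: P_def sum.distrib sum_distrib_right)
      finally show ?thesis .
    qed
    have "P {} + P {(e, True), (e, False)} \<noteq> 0"
    proof (rule asano_contraction)
      fix X Y :: complex
      assume "0 \<le> Re X" "0 \<le> Re Y"
      then show "P {} + P {(e, True)} * X + P {(e, False)} * Y + P {(e, True), (e, False)} * X * Y \<noteq> 0"
        unfolding expand[symmetric] using x by (intro insert.prems) simp
    qed
    also have "P {} + P {(e, True), (e, False)} = (\<Sum>S\<in>Pow (E \<times> UNIV). g' S * (\<Prod>h\<in>S. x h))"
      by (simp add: P_def g'_def algebra_simps sum.distrib)
    finally show "(\<Sum>S\<in>Pow (E \<times> UNIV). g' S * (\<Prod>h\<in>S. x h)) \<noteq> 0" .
  qed
  then show ?case
    by (simp add: sum_Pow_insert[OF insert(1,2)] ins g'_def)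
qed

text \<open>Distributivity: the \<open>B v\<close> being disjoint, picking a subset of each amounts
  to picking one subset of their union.\<close>

lemma prod_sum_Pow:
  fixes f :: "'a \<Rightarrow> 'b set \<Rightarrow> 'c::comm_semiring_1"
  assumes "finite V" and "disjoint_family_on B V"
  shows "(\<Prod>v\<in>V. \<Sum>S\<in>Pow (B v). f v S)
    = (\<Sum>S\<in>Pow (\<Union>v\<in>V. B v). \<Prod>v\<in>V. f v (S \<inter> B v))"
  using assms
proof (induction V rule: finite_induct)
  case (insert v V)
  define U where "U = (\<Union>v\<in>V. B v)"
  have IH: "(\<Prod>v\<in>V. \<Sum>S\<in>Pow (B v). f v S) = (\<Sum>S\<in>Pow U. \<Prod>v\<in>V. f v (S \<inter> B v))"
    unfolding U_def using insert.prems
    by (intro insert.IH) (auto simp: disjoint_family_on_def)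
  have disj: "B v \<inter> U = {}"
    using insert.prems insert.hyps by (auto simp: disjoint_family_on_def U_def)
  have sub: "B w \<subseteq> U" if "w \<in> V" for w
    using that by (auto simp: U_def)
  have "(\<Prod>w\<in>insert v V. \<Sum>S\<in>Pow (B w). f w S)
      = (\<Sum>(R, S)\<in>Pow (B v) \<times> Pow U. f v R * (\<Prod>w\<in>V. f w (S \<inter> B w)))"
    using insert.hyps by (simp add: IH sum_product sum.cartesian_product)
  also have "\<dots> = (\<Sum>S\<in>Pow (B v \<union> U). f v (S \<inter> B v) * (\<Prod>w\<in>V. f w (S \<inter> B w)))"
  proof (rule sum.reindex_bij_witness[where i = "\<lambda>S. (S \<inter> B v, S \<inter> U)" and j = "\<lambda>(R, S). R \<union> S"], goal_cases)
    case (5 a)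
    obtain R S where a: "a = (R, S)" "R \<subseteq> B v" "S \<subseteq> U" using 5 by auto
    have "(R \<union> S) \<inter> B v = R" using a disj by auto
    moreover have "(R \<union> S) \<inter> B w = S \<inter> B w" if "w \<in> V" for w
      using a disj sub[OF that] by auto
    ultimately show ?case by (simp add: a(1))
  qed (use disj in auto)
  finally show ?case using insert.hyps by (simp add: U_def)
qed simp

text \<open>A half-edge is an edge with a bool, attached to a vertex by \<open>vtx\<close>. The
  polarizations at the vertices use disjoint sets of variables; their product is non-zero factor by
  factor, and \<open>contract_edges\<close> reduces its expansion to sets of whole edges.\<close>

lemma fugacity_sum_nonzero:
  fixes c :: "nat \<Rightarrow> complex" and vtx :: "'e \<times> bool \<Rightarrow> 'v"
  assumes fin: "finite V" "finite E"
    and vtx: "\<And>h. h \<in> E \<times> UNIV \<Longrightarrow> vtx h \<in> V"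
    and deg: "\<And>v. v \<in> V \<Longrightarrow> card {h \<in> E \<times> UNIV. vtx h = v} \<le> D"
    and nz: "\<And>y. 0 \<le> Re y \<Longrightarrow> poly (binom_poly D c) y \<noteq> 0"
  shows "(\<Sum>T\<in>Pow E. \<Prod>v\<in>V. c (card {h \<in> T \<times> UNIV. vtx h = v})) \<noteq> 0"
proof (rule contract_edges[OF fin(2)])
  fix x :: "'e \<times> bool \<Rightarrow> complex"
  assume x: "\<And>h. 0 \<le> Re (x h)"
  define B where "B v = {h \<in> E \<times> (UNIV :: bool set). vtx h = v}" for v
  have finE: "finite (E \<times> (UNIV :: bool set))" using fin by simp
  have B: "finite (B v)" for v using finE by (simp add: B_def)
  have "(\<Sum>R\<in>Pow (B v). c (card R) * (\<Prod>h\<in>R. x h)) \<noteq> 0" if "v \<in> V" for v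
  proof (rule grace_walsh_szego[OF B])
    show "poly (binom_poly (card (B v)) c) y \<noteq> 0" if "0 \<le> Re y" for y
      using binom_poly_le_nonzero[OF _ nz that] deg[OF \<open>v \<in> V\<close>] by (simp add: B_def)
  qed (rule x)
  then have "(\<Prod>v\<in>V. \<Sum>R\<in>Pow (B v). c (card R) * (\<Prod>h\<in>R. x h)) \<noteq> 0"
    using fin(1) by simp
  also have "(\<Prod>v\<in>V. \<Sum>R\<in>Pow (B v). c (card R) * (\<Prod>h\<in>R. x h))
      = (\<Sum>S\<in>Pow (\<Union>v\<in>V. B v). \<Prod>v\<in>V. c (card (S \<inter> B v)) * (\<Prod>h\<in>S \<inter> B v. x h))"
    by (rule prod_sum_Pow[OF fin(1)]) (auto simp: disjoint_family_on_def B_def)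
  also have "(\<Union>v\<in>V. B v) = E \<times> UNIV"
    using vtx by (auto simp: B_def)
  also have "(\<Sum>S\<in>Pow (E \<times> UNIV). \<Prod>v\<in>V. c (card (S \<inter> B v)) * (\<Prod>h\<in>S \<inter> B v. x h))
      = (\<Sum>S\<in>Pow (E \<times> UNIV). (\<Prod>v\<in>V. c (card {h \<in> S. vtx h = v})) * (\<Prod>h\<in>S. x h))"
  proof (rule sum.cong[OF refl])
    fix S assume S: "S \<in> Pow (E \<times> (UNIV :: bool set))"
    then have "S \<inter> B v = {h \<in> S. vtx h = v}" for v by (auto simp: B_def)
    moreover have "(\<Prod>v\<in>V. \<Prod>h\<in>{h \<in> S. vtx h = v}. x h) = (\<Prod>h\<in>S. x h)"
      using S vtx finE by (intro prod.group fin) (auto intro: finite_subset)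
    ultimately show "(\<Prod>v\<in>V. c (card (S \<inter> B v)) * (\<Prod>h\<in>S \<inter> B v. x h))
        = (\<Prod>v\<in>V. c (card {h \<in> S. vtx h = v})) * (\<Prod>h\<in>S. x h)"
      by (simp add: prod.distrib)
  qed
  finally show "(\<Sum>S\<in>Pow (E \<times> UNIV). (\<Prod>v\<in>V. c (card {h \<in> S. vtx h = v})) * (\<Prod>h\<in>S. x h)) \<noteq> 0" .
qed

subsection \<open>Shifting the zeros of a polynomial\<close>

lemma poly_of_real_sum_monom:
  "poly (map_poly complex_of_real (\<Sum>k\<in>A. monom (a k) k)) z = (\<Sum>k\<in>A. of_real (a k) * z ^ k)"
proof -
  have "map_poly complex_of_real (\<Sum>k\<in>A. monom (a k) k) = (\<Sum>k\<in>A. monom (of_real (a k)) k)"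
    by (rule poly_eqI) (auto simp: coeff_map_poly coeff_sum intro!: sum.cong)
  then show ?thesis by (simp add: poly_sum poly_monom)
qed

lemma poly_of_real_pcompose_shift:
  "poly (map_poly complex_of_real (pcompose p [:e, 1:])) z = poly (map_poly complex_of_real p) (z + of_real e)"
proof (induction p)
  case (pCons a p)
  have add: "map_poly complex_of_real (q + r) = map_poly of_real q + map_poly of_real r" for q r
    by (rule poly_eqI) (simp add: coeff_map_poly)
  show ?case
    by (simp add: pcompose_pCons add map_poly_pCons map_poly_smult pCons.IH algebra_simps)
qed simp

text \<open>By Horner's scheme the coefficients of p(y + e) depend continuously on e; this makes the
  approximating fugacities converge.\<close>

lemma tendsto_coeff_pcompose_shift:
  fixes p :: "'a::real_normed_field poly"
  assumes "(e \<longlongrightarrow> 0) F"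
  shows "((\<lambda>n. coeff (pcompose p [:e n, 1:]) k) \<longlongrightarrow> coeff p k) F"
proof (induction p arbitrary: k)
  case (pCons a p)
  show ?case
  proof (cases k)
    case 0
    have "((\<lambda>n. a + e n * coeff (pcompose p [:e n, 1:]) 0) \<longlongrightarrow> a + 0 * coeff p 0) F"
      by (intro tendsto_intros assms pCons.IH)
    then show ?thesis by (simp add: 0 pcompose_pCons)
  next
    case (Suc j)
    have "((\<lambda>n. e n * coeff (pcompose p [:e n, 1:]) (Suc j) + coeff (pcompose p [:e n, 1:]) j)
        \<longlongrightarrow> 0 * coeff p (Suc j) + coeff p j) F"
      by (intro tendsto_intros assms pCons.IH)
    then show ?thesis by (simp add: Suc pcompose_pCons)
  qed
qed simp

lemma uniform_limit_sum:
  fixes f :: "'i \<Rightarrow> 'a \<Rightarrow> 'b \<Rightarrow> 'c::real_normed_vector"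
  assumes "\<And>i. i \<in> I \<Longrightarrow> uniform_limit X (f i) (l i) F"
  shows "uniform_limit X (\<lambda>n x. \<Sum>i\<in>I. f i n x) (\<lambda>x. \<Sum>i\<in>I. l i x) F"
  using assms
  by (induction I rule: infinite_finite_induct) (auto intro!: uniform_limit_intros)

subsection \<open>The degree-weighted enumerator of a multigraph\<close>

lemma Gamma_poly_eq_binom_poly: "Gamma_poly D u = binom_poly D u"
  by (simp add: Gamma_poly_def binom_poly_def)

context finite_multigraph
begin

lemma sub_degree_le:
  assumes "max_degree G \<le> D" "v \<in> verts G"
  shows "sub_degree G (edges G) v \<le> D"
  using assms Max_ge[of "insert 0 (sub_degree G (edges G) ` verts G)"] finite_verts
  unfolding max_degree_def by fastforce

lemma sub_degree_mono:
  assumes "H \<subseteq> edges G"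
  shows "sub_degree G H v \<le> sub_degree G (edges G) v"
  unfolding sub_degree_def using assms finite_edges by (intro sum_mono2) auto

text \<open>Handshake lemma; it turns one factor s per unit of degree into s^2 = t per edge.\<close>

lemma sum_sub_degree:
  assumes "H \<subseteq> edges G"
  shows "(\<Sum>v\<in>verts G. sub_degree G H v) = 2 * card H"
proof -
  have "(\<Sum>v\<in>verts G. count (ends G e) v) = 2" if "e \<in> H" for e
  proof -
    have e: "e \<in> edges G" using that assms by auto
    have "(\<Sum>v\<in>verts G. count (ends G e) v) = (\<Sum>v\<in>set_mset (ends G e). count (ends G e) v)"
      using ends_in_verts[OF e] finite_verts
      by (intro sum.mono_neutral_right) (auto simp: not_in_iff)
    then show ?thesis using size_ends[OF e] by (simp add: size_multiset_overloaded_eq)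
  qed
  then show ?thesis
    unfolding sub_degree_def by (subst sum.swap) simp
qed

text \<open>The endpoints of an edge are ordered arbitrarily and the bool selects one. A loop has
  both halves at the same vertex and so counts twice.\<close>

lemma obtain_half_edges:
  obtains vtx :: "'e \<times> bool \<Rightarrow> 'v" where
    "\<And>h. h \<in> edges G \<times> UNIV \<Longrightarrow> vtx h \<in> verts G"
    "\<And>H v. H \<subseteq> edges G \<Longrightarrow> card {h \<in> H \<times> UNIV. vtx h = v} = sub_degree G H v"
proof -
  have "\<exists>p. ends G e = {#fst p, snd p#}" if "e \<in> edges G" for e
  proof -
    have "size (ends G e) = Suc 1" using size_ends[OF that] by simp
    then obtain a M where "ends G e = add_mset a M" "size M = 1"
      by (metis size_eq_Suc_imp_eq_union size_add_mset nat.inject)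
    then show ?thesis by (metis fst_conv snd_conv size_1_singleton_mset)
  qed
  then obtain p where p: "\<And>e. e \<in> edges G \<Longrightarrow> ends G e = {#fst (p e), snd (p e)#}"
    by metis
  define vtx where "vtx h = (if snd h then fst (p (fst h)) else snd (p (fst h)))" for h :: "'e \<times> bool"
  show thesis
  proof
    show "vtx h \<in> verts G" if "h \<in> edges G \<times> UNIV" for h
      using that ends_in_verts p by (fastforce simp: vtx_def)
  next
    fix H v assume H: "H \<subseteq> edges G"
    then have fin: "finite H" using finite_edges finite_subset by blast
    have "card {h \<in> H \<times> UNIV. vtx h = v} = (\<Sum>h\<in>H \<times> UNIV. if vtx h = v then 1 else 0)"
      using fin by (simp flip: sum.inter_filter)
    also have "\<dots> = (\<Sum>e\<in>H. \<Sum>b\<in>UNIV. if vtx (e, b) = v then 1 else 0)"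
      by (simp add: sum.cartesian_product)
    also have "\<dots> = sub_degree G H v"
      unfolding sub_degree_def
    proof (rule sum.cong[OF refl])
      fix e assume "e \<in> H"
      then have "e \<in> edges G" using H by auto
      then show "(\<Sum>b\<in>UNIV. if vtx (e, b) = v then 1 else 0) = count (ends G e) v"
        by (simp add: p vtx_def UNIV_bool)
    qed
    finally show "card {h \<in> H \<times> UNIV. vtx h = v} = sub_degree G H v" .
  qed
qed

lemma poly_N_poly:
  "poly (map_poly complex_of_real (N_poly G u)) t
    = (\<Sum>H\<in>Pow (edges G). of_real (sub_weight G u H) * t ^ card H)"
proof -
  have "poly (map_poly complex_of_real (N_poly G u)) t
      = (\<Sum>j\<le>card (edges G). \<Sum>H | H \<in> Pow (edges G) \<and> card H = j. of_real (sub_weight G u H) * t ^ card H)"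
    unfolding N_poly_def poly_of_real_sum_monom
    by (intro sum.cong refl) (simp add: N_def sum_distrib_right)
  also have "\<dots> = (\<Sum>H\<in>Pow (edges G). of_real (sub_weight G u H) * t ^ card H)"
    using finite_edges by (intro sum.group) (auto intro: card_mono)
  finally show ?thesis .
qed

text \<open>The case of strictly negative zeros. A zero at the origin is excluded because the closed
  half-plane used for the polarizations contains 0.\<close>

lemma N_poly_nonzero:
  assumes deg: "max_degree G \<le> D"
    and Gamma: "\<And>z. poly (map_poly complex_of_real (Gamma_poly D u)) z = 0 \<Longrightarrow> z \<in> \<real>\<^sub>\<le>\<^sub>0 - {0}"
    and t: "t \<notin> \<real>\<^sub>\<le>\<^sub>0"
  shows "poly (map_poly complex_of_real (N_poly G u)) t \<noteq> 0"
proof -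
  define s where "s = csqrt t"
  have st: "s\<^sup>2 = t" by (simp add: s_def)
  have "0 < Re s"
  proof (rule ccontr)
    assume "\<not> 0 < Re s"
    then have "Re s = 0" using csqrt_principal[of t] by (auto simp: s_def)
    then have "t = of_real (- (Im s)\<^sup>2)"
      unfolding st[symmetric] by (simp add: complex_eq_iff power2_eq_square)
    then show False using t by (metis neg_le_0_iff_le nonpos_Reals_of_real_iff zero_le_power2)
  qed
  define c where "c k = of_real (u k) * s ^ k" for k
  have nz: "poly (binom_poly D c) y \<noteq> 0" if "0 \<le> Re y" for y
  proof
    assume "poly (binom_poly D c) y = 0"
    then have "poly (map_poly complex_of_real (Gamma_poly D u)) (s * y) = 0"
      unfolding Gamma_poly_def poly_of_real_sum_monom binom_poly_def poly_sum poly_monom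
      by (simp add: c_def power_mult_distrib mult_ac)
    then have "s * y \<in> \<real>\<^sub>\<le>\<^sub>0" "s * y \<noteq> 0" using Gamma by blast+
    then obtain r where r: "s * y = of_real r" "r < 0"
      by (metis less_eq_real_def nonpos_Reals_cases of_real_0)
    have "s \<noteq> 0" using \<open>0 < Re s\<close> by auto
    \<comment> \<open>Thus \<open>y\<close> is a negative multiple of the conjugate of
      \<open>s\<close> and lies in the open left half-plane.\<close>
    then have y: "y = of_real r / s" using r(1) by (simp add: field_simps)
    have "Re y = r * Re s / (cmod s)\<^sup>2"
      by (simp add: y Re_divide cmod_power2)
    also have "\<dots> < 0"
      using r(2) \<open>0 < Re s\<close> \<open>s \<noteq> 0\<close> by (intro divide_neg_pos mult_neg_pos) auto
    finally show False using that by simp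
  qed
  obtain vtx :: "'e \<times> bool \<Rightarrow> 'v" where
    vtx: "\<And>h. h \<in> edges G \<times> UNIV \<Longrightarrow> vtx h \<in> verts G"
      "\<And>H v. H \<subseteq> edges G \<Longrightarrow> card {h \<in> H \<times> UNIV. vtx h = v} = sub_degree G H v"
    using obtain_half_edges by blast
  have "(\<Sum>H\<in>Pow (edges G). \<Prod>v\<in>verts G. c (card {h \<in> H \<times> UNIV. vtx h = v})) \<noteq> 0"
    using finite_verts finite_edges vtx sub_degree_le[OF deg] nz
    by (intro fugacity_sum_nonzero[where D = D]) auto
  also have "(\<Sum>H\<in>Pow (edges G). \<Prod>v\<in>verts G. c (card {h \<in> H \<times> UNIV. vtx h = v}))
      = (\<Sum>H\<in>Pow (edges G). of_real (sub_weight G u H) * t ^ card H)"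
  proof (rule sum.cong[OF refl])
    fix H assume "H \<in> Pow (edges G)"
    then have H: "H \<subseteq> edges G" by simp
    have "(\<Prod>v\<in>verts G. c (sub_degree G H v))
        = of_real (sub_weight G u H) * s ^ (\<Sum>v\<in>verts G. sub_degree G H v)"
      by (simp add: c_def prod.distrib sub_weight_def power_sum)
    then show "(\<Prod>v\<in>verts G. c (card {h \<in> H \<times> UNIV. vtx h = v})) = of_real (sub_weight G u H) * t ^ card H"
      by (simp add: vtx(2)[OF H] sum_sub_degree[OF H] power_mult st)
  qed
  finally show ?thesis by (simp add: poly_N_poly)
qed

text \<open>The shift by \<open>e n\<close> moves zeros at the origin strictly to its left, where
  \<open>N_poly_nonzero\<close> applies; Hurwitz's theorem carries the non-vanishing over to the
  limit.\<close>

lemma only_real_nonpos_zeros_N_poly: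
  assumes deg: "max_degree G \<le> D"
    and Gamma: "only_real_nonpos_zeros (Gamma_poly D u)" "Gamma_poly D u \<noteq> 0"
  shows "only_real_nonpos_zeros (N_poly G u)"
proof -
  define p where "p = Gamma_poly D u"
  define e where "e n = inverse (real (Suc n))" for n
  have e: "e \<longlonglongrightarrow> 0"
    using LIMSEQ_inverse_real_of_nat by (simp only: e_def[abs_def])
  have e_pos: "0 < e n" for n by (simp add: e_def)
  \<comment> \<open>Fugacities read off from the shifted polynomial. For k > \<open>D\<close> the
    quotient is 0, so convergence to \<open>u k\<close> is claimed only for k \<le>
    \<open>D\<close>, the range of the degrees.\<close>
  define w where "w n k = coeff (pcompose p [:e n, 1:]) k / real (D choose k)" for n k
  have coeff_p: "coeff p k = real (D choose k) * u k" for k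
    by (simp add: p_def Gamma_poly_eq_binom_poly coeff_binom_poly)
  have "degree p \<le> D"
    by (simp add: p_def Gamma_poly_eq_binom_poly degree_binom_poly)
  have Gamma_w: "Gamma_poly D (w n) = pcompose p [:e n, 1:]" for n
  proof (rule poly_eqI)
    fix k
    have "degree (pcompose p [:e n, 1:]) \<le> D"
      using degree_pcompose_le[of p "[:e n, 1:]"] \<open>degree p \<le> D\<close> by simp
    then show "coeff (Gamma_poly D (w n)) k = coeff (pcompose p [:e n, 1:]) k"
      by (cases "k \<le> D") (simp_all add: Gamma_poly_eq_binom_poly coeff_binom_poly w_def coeff_eq_0 not_le)
  qed
  have zeros_w: "z \<in> \<real>\<^sub>\<le>\<^sub>0 - {0}"
    if "poly (map_poly complex_of_real (Gamma_poly D (w n))) z = 0" for n z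
  proof -
    have "z + of_real (e n) \<in> \<real>\<^sub>\<le>\<^sub>0"
      using that Gamma by (simp add: Gamma_w poly_of_real_pcompose_shift only_real_nonpos_zeros_def p_def)
    then obtain r where r: "z + of_real (e n) = of_real r" "r \<le> 0"
      by (rule nonpos_Reals_cases)
    then have "z = of_real (r - e n)" by (simp add: algebra_simps)
    then show ?thesis using r(2) e_pos[of n] by (auto simp del: of_real_diff)
  qed
  have weight: "(\<lambda>n. sub_weight G (w n) H) \<longlonglongrightarrow> sub_weight G u H" if "H \<subseteq> edges G" for H
    unfolding sub_weight_def
  proof (rule tendsto_prod)
    fix v assume "v \<in> verts G"
    define k where "k = sub_degree G H v"
    have "k \<le> D"
      using sub_degree_mono[OF that] sub_degree_le[OF deg \<open>v \<in> verts G\<close>] k_def le_trans by blast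
    have "(\<lambda>n. w n k) \<longlonglongrightarrow> coeff p k / real (D choose k)"
      unfolding w_def using \<open>k \<le> D\<close> by (intro tendsto_intros tendsto_coeff_pcompose_shift e) simp
    then show "(\<lambda>n. w n k) \<longlonglongrightarrow> u k"
      using \<open>k \<le> D\<close> by (simp add: coeff_p)
  qed
  define f where "f = poly (map_poly complex_of_real (N_poly G u))"
  let ?S = "- (complex_of_real ` {..0})"
  have S: "?S = - \<real>\<^sub>\<le>\<^sub>0" by (auto simp: nonpos_Reals_def)
  have "f z \<noteq> 0" if z: "z \<notin> \<real>\<^sub>\<le>\<^sub>0" and "N_poly G u \<noteq> 0" for z
  \<comment> \<open>Hurwitz's theorem needs a non-constant limit. If \<open>f\<close> is constant
    with value 0, every positive real is a root of the non-zero \<open>N_poly G u\<close>, which is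
    absurd.\<close>
  proof (cases "f constant_on ?S")
    case True
    then obtain c where c: "f z = c" if "z \<notin> \<real>\<^sub>\<le>\<^sub>0" for z
      unfolding S by (auto simp: constant_on_def)
    have "c \<noteq> 0"
    proof
      assume "c = 0"
      have "f (of_real x) = 0" if "0 < x" for x
        using c[of "of_real x"] \<open>c = 0\<close> that by auto
      then have "complex_of_real ` {0<..} \<subseteq> {z. f z = 0}" by auto
      moreover have "infinite (complex_of_real ` {0<..})"
        by (simp add: finite_image_iff inj_on_def infinite_Ioi)
      ultimately have "infinite {z. f z = 0}"
        using finite_subset by blast
      then have "map_poly complex_of_real (N_poly G u) = 0"
        using poly_roots_finite f_def by blast
      then show False
        using \<open>N_poly G u \<noteq> 0\<close> by (simp add: map_poly_eq_0_iff)
    qed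
    then show ?thesis using c[OF z] by simp
  next
    case False
    show ?thesis
    proof (rule Hurwitz_no_zeros[where S = ?S
          and \<F> = "\<lambda>n. poly (map_poly complex_of_real (N_poly G (w n)))" and g = f])
      show "open ?S" by (simp add: S open_Compl)
      show "connected ?S"
        by (intro starlike_imp_connected starlike_slotted_complex_plane_left)
      show "poly (map_poly complex_of_real (N_poly G (w n))) z \<noteq> 0" if "z \<in> ?S" for n z
        using that zeros_w by (intro N_poly_nonzero[OF deg]) (auto simp: S)
      show "uniform_limit K (\<lambda>n. poly (map_poly complex_of_real (N_poly G (w n)))) f sequentially"
        if "compact K" for K
      proof -
        have "uniform_limit K (\<lambda>n t. \<Sum>H\<in>Pow (edges G). of_real (sub_weight G (w n) H) * t ^ card H)
            (\<lambda>t. \<Sum>H\<in>Pow (edges G). of_real (sub_weight G u H) * t ^ card H) sequentially"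
        proof (rule uniform_limit_sum)
          fix H assume "H \<in> Pow (edges G)"
          then have "(\<lambda>n. complex_of_real (sub_weight G (w n) H)) \<longlonglongrightarrow> of_real (sub_weight G u H)"
            by (intro tendsto_of_real weight) simp
          \<comment> \<open>The factor varying with n is constant in t, and the monomial is bounded
            on the compact set \<open>K\<close>.\<close>
          then show "uniform_limit K (\<lambda>n t. complex_of_real (sub_weight G (w n) H) * t ^ card H)
              (\<lambda>t. of_real (sub_weight G u H) * t ^ card H) sequentially"
            using that
            by (intro uniform_lim_mult uniform_limit_const compact_imp_bounded compact_continuous_image continuous_intros)
              (auto simp: uniform_limit_iff tendsto_iff)
        qed
        then show ?thesis by (simp add: f_def poly_N_poly[abs_def])
      qed
    qed (use False z in \<open>auto simp: S f_def intro!: holomorphic_intros\<close>)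
  qed
  then show ?thesis by (auto simp: only_real_nonpos_zeros_def f_def)
qed

end

theorem proposition6:
  fixes G :: "('v, 'e) multigraph" and D :: nat and u :: "nat \<Rightarrow> real"
  assumes "finite_multigraph G"
    and "D > 0"
    and "max_degree G \<le> D"
    and "\<And>k. 0 \<le> u k"
    and "only_real_nonpos_zeros (Gamma_poly D u)"
  shows "only_real_nonpos_zeros (N_poly G u)"
proof (cases "Gamma_poly D u = 0")
  case False
  then show ?thesis
    using finite_multigraph.only_real_nonpos_zeros_N_poly assms(1,3,5) by blast
next
  case True
  interpret finite_multigraph G by fact
  have u: "u k = 0" if "k \<le> D" for k
  proof -
    have "real (D choose k) * u k = coeff (Gamma_poly D u) k"
      by (simp add: Gamma_poly_eq_binom_poly coeff_binom_poly)
    then show ?thesis using True that by simp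
  qed
  show ?thesis
  proof (cases "verts G = {}")
    case True
    \<comment> \<open>Without vertices the only weight is an empty product, so the enumerator is the
      constant 1 and has no zeros.\<close>
    then have "edges G = {}"
      using size_ends ends_in_verts by fastforce
    then show ?thesis
      using True by (simp add: only_real_nonpos_zeros_def poly_N_poly sub_weight_def)
  next
    case False
    then obtain v where v: "v \<in> verts G" by blast
    have "sub_weight G u H = 0" if "H \<subseteq> edges G" for H
    proof -
      have "u (sub_degree G H v) = 0"
        using sub_degree_mono[OF that] sub_degree_le[OF assms(3) v] u le_trans by blast
      then show ?thesis
        unfolding sub_weight_def using v finite_verts by (meson prod_zero)
    qed
    then show ?thesis
      by (simp add: only_real_nonpos_zeros_def N_poly_def N_def)
  qed
qed

end
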